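(* Let $A \in \mathbf{R}^{m\times n}$ be a matrix whose nonzero singular values are all distinct, let $k \ge 1$ be an integer, and let $\gamma \ge 0$. Then the quadratically regularized PCA problem $$\mbox{minimize} \quad \|A - XY\|_F^2 + \gamma\|X\|_F^2 + \gamma\|Y\|_F^2,$$ with variables $X \in \mathbf{R}^{m\times k}$ and $Y \in \mathbf{R}^{k\times n}$, has only one local minimum, which is the global minimum.
   Context: $\|\cdot\|_F$ is the Frobenius norm, i.e., the square root of the sum of the squares of the entries. *)

theory Defs
  imports "HOL-Analysis.Analysis"
begin

definition frobenius_norm :: "real^'n^'m \<Rightarrow> real" where
  "frobenius_norm A = sqrt (\<Sum>i\<in>UNIV. \<Sum>j\<in>UNIV. (A $ i $ j)\<^sup>2)"

text \<open>
  The norm instance on nested vectors is the Frobenius norm, so the topology that defines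
  local minima below is the Euclidean one on the entries.
\<close>

lemma frobenius_norm_eq_norm: "frobenius_norm A = norm A"
  by (simp add: frobenius_norm_def norm_vec_def L2_set_def sum_nonneg)

text \<open>
  A singular value decomposition \<open>A = U \<Sigma> V\<^sup>T\<close> in thin form: \<open>u i\<close> and \<open>v i\<close> for \<open>i < r\<close>
  are the columns of \<open>U\<close> and \<open>V\<close>, and \<open>\<sigma> i\<close> for \<open>i < r\<close> lists the nonzero singular values of
  \<open>A\<close> with multiplicity, so that \<open>r\<close> is the rank of \<open>A\<close>. The index is a natural number because
  \<open>r\<close> depends on \<open>A\<close> and may be 0.
\<close>

definition is_svd ::
  "real^'n^'m \<Rightarrow> nat \<Rightarrow> (nat \<Rightarrow> real^'m) \<Rightarrow> (nat \<Rightarrow> real) \<Rightarrow> (nat \<Rightarrow> real^'n) \<Rightarrow> bool" where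
  "is_svd A r u \<sigma> v \<longleftrightarrow>
     (\<forall>i<r. \<sigma> i > 0) \<and>
     (\<forall>i<r. \<forall>j<r. u i \<bullet> u j = (if i = j then 1 else 0)) \<and>
     (\<forall>i<r. \<forall>j<r. v i \<bullet> v j = (if i = j then 1 else 0)) \<and>
     A = (\<chi> a b. \<Sum>i<r. \<sigma> i * u i $ a * v i $ b)"

text \<open>
  Every real matrix has a decomposition of this form and the \<open>\<sigma> i\<close> are unique up to order,
  so it does not matter which decomposition is inspected.
\<close>

definition distinct_nonzero_singular_values :: "real^'n^'m \<Rightarrow> bool" where
  "distinct_nonzero_singular_values A \<longleftrightarrow>
     (\<exists>r u \<sigma> v. is_svd A r u \<sigma> v \<and> inj_on \<sigma> {..<r})"

definition rpca_objective ::
  "real^'n^'m \<Rightarrow> real \<Rightarrow> (real^'k^'m) \<times> (real^'n^'k) \<Rightarrow> real" where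
  "rpca_objective A \<gamma> = (\<lambda>(X, Y).
     (frobenius_norm (A - X ** Y))\<^sup>2 + \<gamma> * (frobenius_norm X)\<^sup>2 + \<gamma> * (frobenius_norm Y)\<^sup>2)"

definition local_minimizer :: "('a::topological_space \<Rightarrow> real) \<Rightarrow> 'a \<Rightarrow> bool" where
  "local_minimizer f x \<longleftrightarrow> (\<forall>\<^sub>F y in nhds x. f x \<le> f y)"

definition global_minimizer :: "('a \<Rightarrow> real) \<Rightarrow> 'a \<Rightarrow> bool" where
  "global_minimizer f x \<longleftrightarrow> (\<forall>y. f x \<le> f y)"

end

theory Submission
  imports Defs
begin

text \<open>
  At a stationary point the residual \<open>R = A - X Y\<close> satisfies \<open>R Y\<^sup>T = \<gamma> X\<close> and \<open>X\<^sup>T R = \<gamma> Y\<close>.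
  These equations make \<open>X X\<^sup>T\<close> (or \<open>X Y (X Y)\<^sup>T\<close> when \<open>\<gamma> = 0\<close>) commute with \<open>A A\<^sup>T\<close>, and since
  the nonzero singular values are simple, the \<open>u i\<close> are its eigenvectors; it follows that
  \<open>X Y\<close> is the sum of \<open>(\<sigma> i - \<gamma>) u i (v i)\<^sup>T\<close> over a set \<open>I\<close> of at most \<open>k\<close> indices with
  \<open>\<sigma> i > \<gamma>\<close>. The second-order condition forces \<open>I\<close> to consist of the largest such singular
  values, and as many of them as \<open>k\<close> allows, so that \<open>X Y\<close> is the same for all local minimizers.
  The objective value at a stationary point depends only on \<open>X Y\<close>, hence all local minima have the
  value of the global one. A global minimizer exists by coercivity for \<open>\<gamma> > 0\<close>; for \<open>\<gamma> = 0\<close>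
  it is a limit of minimizers for \<open>\<gamma> \<rightarrow> 0\<close>, which stay bounded because they are balanced,
  \<open>X\<^sup>T X = Y Y\<^sup>T\<close>.
\<close>

text \<open>These rules would turn \<open>transpose A *v x\<close> into \<open>x v* A\<close>; the
  adjoint computations below keep the transposed form.\<close>

declare transpose_matrix_vector [simp del] vector_transpose_matrix [simp del]

section \<open>Outer products, bilinearity and adjoints of matrix multiplication\<close>

definition outer :: "real^'m \<Rightarrow> real^'n \<Rightarrow> real^'n^'m" where
  "outer p q = (\<chi> a b. p $ a * q $ b)"

lemma matrix_mult_outer: "B ** outer p q = outer (B *v p) q"
  by (simp add: outer_def matrix_matrix_mult_def matrix_vector_mult_def vec_eq_iff
      sum_distrib_right mult.assoc)

lemma outer_matrix_mult: "outer p q ** B = outer p (transpose B *v q)"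
  by (simp add: outer_def matrix_matrix_mult_def matrix_vector_mult_def transpose_def vec_eq_iff
      sum_distrib_left mult_ac)

lemma outer_matrix_vector_mult: "outer p q *v z = (q \<bullet> z) *\<^sub>R p"
  by (simp add: outer_def matrix_vector_mult_def inner_vec_def vec_eq_iff
      sum_distrib_left mult_ac)

lemma inner_outer: "B \<bullet> outer p q = p \<bullet> (B *v q)"
  by (simp add: outer_def matrix_vector_mult_def inner_vec_def sum_distrib_left mult_ac)

lemma outer_scaleR [simp]:
  "outer (c *\<^sub>R p) q = c *\<^sub>R outer p q" "outer p (c *\<^sub>R q) = c *\<^sub>R outer p q"
  by (simp_all add: outer_def vec_eq_iff)

lemma scaleR_outer_matrix_vector_mult: "(c *\<^sub>R outer p q) *v z = (c * (q \<bullet> z)) *\<^sub>R p"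
  using outer_matrix_vector_mult[of "c *\<^sub>R p" q z] by (simp add: mult.commute)

lemma outer_zero [simp]: "outer 0 q = 0" "outer p 0 = 0"
  by (simp_all add: outer_def vec_eq_iff)

lemma inner_outer_outer: "outer p q \<bullet> outer p' q' = (p \<bullet> p') * (q \<bullet> q')"
  by (simp add: inner_outer outer_matrix_vector_mult inner_commute)

text \<open>Supplies the distributive rules collected next and, later, continuity of the
  objective.\<close>

lemma bounded_bilinear_matrix_mult:
  "bounded_bilinear ((**) :: real^'k^'m \<Rightarrow> real^'n^'k \<Rightarrow> real^'n^'m)"
  unfolding bilinear_conv_bounded_bilinear[symmetric] bilinear_def
  by (auto intro!: linearI simp: matrix_matrix_mult_def vec_eq_iff algebra_simps
      sum.distrib sum_distrib_left)

lemmas matrix_mult_bilinear =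
  bounded_bilinear.add_left[OF bounded_bilinear_matrix_mult]
  bounded_bilinear.add_right[OF bounded_bilinear_matrix_mult]
  bounded_bilinear.diff_left[OF bounded_bilinear_matrix_mult]
  bounded_bilinear.diff_right[OF bounded_bilinear_matrix_mult]
  bounded_bilinear.scaleR_left[OF bounded_bilinear_matrix_mult]
  bounded_bilinear.scaleR_right[OF bounded_bilinear_matrix_mult]
  bounded_bilinear.zero_left[OF bounded_bilinear_matrix_mult]
  bounded_bilinear.zero_right[OF bounded_bilinear_matrix_mult]

lemma inner_transpose_vector:
  fixes A :: "real^'n^'m"
  shows "x \<bullet> (transpose A *v y) = (A *v x) \<bullet> y"
  by (metis dot_lmul_matrix inner_commute transpose_matrix_vector)

lemma inner_matrix_vector:
  fixes A :: "real^'n^'m"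
  shows "x \<bullet> (A *v y) = (transpose A *v x) \<bullet> y"
  using inner_transpose_vector[of y A x] by (simp add: inner_commute)

text \<open>The inner product of matrices is the trace form, so the map
  \<open>B \<mapsto> B ** C\<close> has the adjoint
  \<open>D \<mapsto> D ** transpose C\<close>.\<close>

lemma inner_matrix_mult_left:
  fixes B :: "real^'k^'m" and C :: "real^'n^'k"
  shows "D \<bullet> (B ** C) = (D ** transpose C) \<bullet> B"
proof -
  have "D \<bullet> (B ** C) = (\<Sum>i\<in>UNIV. \<Sum>j\<in>UNIV. \<Sum>l\<in>UNIV. D$i$j * (B$i$l * C$l$j))"
    by (simp add: inner_vec_def matrix_matrix_mult_def sum_distrib_left)
  also have "\<dots> = (\<Sum>i\<in>UNIV. \<Sum>l\<in>UNIV. \<Sum>j\<in>UNIV. D$i$j * (B$i$l * C$l$j))"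
    by (intro sum.cong refl sum.swap)
  also have "\<dots> = (D ** transpose C) \<bullet> B"
    by (simp add: inner_vec_def matrix_matrix_mult_def transpose_def sum_distrib_left mult_ac)
  finally show ?thesis .
qed

lemma inner_transpose_transpose:
  fixes B :: "real^'n^'m"
  shows "transpose B \<bullet> transpose C = B \<bullet> C"
  unfolding inner_vec_def transpose_def by (simp, rule sum.swap)

lemma inner_matrix_mult_right:
  fixes B :: "real^'k^'m" and C :: "real^'n^'k"
  shows "D \<bullet> (B ** C) = (transpose B ** D) \<bullet> C"
  using inner_matrix_mult_left[of "transpose D" "transpose C" "transpose B"]
  by (metis inner_transpose_transpose matrix_transpose_mul transpose_transpose)

lemma transpose_add: "transpose (A + B) = transpose A + transpose B"
  by (simp add: transpose_def vec_eq_iff)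

section \<open>First- and second-order optimality conditions\<close>

text \<open>Dividing by \<open>t\<close> on the right and on the left of 0 gives both signs of
  \<open>a\<close>; once \<open>a\<close> vanishes, dividing by \<open>t^2\<close> and letting
  \<open>t\<close> tend to 0 gives the sign of \<open>b\<close>.\<close>

lemma polynomial_nonneg_near_0:
  fixes a b c d :: real
  assumes "\<forall>\<^sub>F t in at 0. 0 \<le> t * a + t^2 * b + t^3 * c + t^4 * d"
  shows "a = 0" "b \<ge> 0"
proof -
  have ev: "\<forall>\<^sub>F t in at_right 0. 0 \<le> t * a + t^2 * b + t^3 * c + t^4 * d"
    "\<forall>\<^sub>F t in at_left 0. 0 \<le> t * a + t^2 * b + t^3 * c + t^4 * d"
    using assms by (simp_all add: eventually_at_split)
  have lim: "((\<lambda>t. a + t * b + t^2 * c + t^3 * d) \<longlongrightarrow> a + 0 * b + 0^2 * c + 0^3 * d)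
    (at 0 within S)" for S
    by (intro tendsto_intros)
  have "0 \<le> a"
  proof (rule tendsto_lowerbound)
    show "((\<lambda>t. a + t * b + t^2 * c + t^3 * d) \<longlongrightarrow> a) (at_right 0)" using lim by simp
    have "\<forall>\<^sub>F t in at_right 0. (0::real) < t" by (simp add: eventually_at_filter)
    then show "\<forall>\<^sub>F t in at_right 0. 0 \<le> a + t * b + t^2 * c + t^3 * d" using ev(1)
    proof eventually_elim
      case (elim t)
      have "0 \<le> t * (a + t * b + t^2 * c + t^3 * d)"
        using elim(2) by (simp add: algebra_simps power_numeral_reduce)
      with elim(1) show ?case by (simp add: zero_le_mult_iff)
    qed
  qed simp
  moreover have "a \<le> 0"
  proof (rule tendsto_upperbound)
    show "((\<lambda>t. a + t * b + t^2 * c + t^3 * d) \<longlongrightarrow> a) (at_left 0)" using lim by simp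
    have "\<forall>\<^sub>F t in at_left 0. t < (0::real)" by (simp add: eventually_at_filter)
    then show "\<forall>\<^sub>F t in at_left 0. a + t * b + t^2 * c + t^3 * d \<le> 0" using ev(2)
    proof eventually_elim
      case (elim t)
      have "0 \<le> t * (a + t * b + t^2 * c + t^3 * d)"
        using elim(2) by (simp add: algebra_simps power_numeral_reduce)
      with elim(1) show ?case by (simp add: zero_le_mult_iff)
    qed
  qed simp
  ultimately show a: "a = 0" by simp
  show "b \<ge> 0"
  proof (rule tendsto_lowerbound)
    have "((\<lambda>t. b + t * c + t^2 * d) \<longlongrightarrow> b + 0 * c + 0^2 * d) (at_right 0)"
      by (intro tendsto_intros)
    then show "((\<lambda>t. b + t * c + t^2 * d) \<longlongrightarrow> b) (at_right 0)" by simp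
    have "\<forall>\<^sub>F t in at_right 0. (0::real) < t" by (simp add: eventually_at_filter)
    then show "\<forall>\<^sub>F t in at_right 0. 0 \<le> b + t * c + t^2 * d" using ev(1)
    proof eventually_elim
      case (elim t)
      have "0 \<le> t^2 * (b + t * c + t^2 * d)"
        using elim(2) a by (simp add: algebra_simps power_numeral_reduce)
      with elim(1) show ?case by (simp add: zero_le_mult_iff)
    qed
  qed simp
qed

lemma rpca_objective_eq_inner:
  "rpca_objective A \<gamma> (X, Y) = (A - X ** Y) \<bullet> (A - X ** Y) + \<gamma> * (X \<bullet> X) + \<gamma> * (Y \<bullet> Y)"
  by (simp add: rpca_objective_def frobenius_norm_eq_norm power2_norm_eq_inner)

text \<open>Along the line \<open>(X + t P, Y + t Q)\<close> the objective is a quartic in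
  \<open>t\<close>: the product \<open>X Y\<close> changes by \<open>t D + t^2 E\<close> with
  \<open>D = P Y + X Q\<close> and \<open>E = P Q\<close>. The two claims concern its linear and
  quadratic coefficients.\<close>

lemma local_minimizer_rpca:
  fixes A :: "real^'n^'m" and X P :: "real^'k^'m" and Y Q :: "real^'n^'k"
  assumes "local_minimizer (rpca_objective A \<gamma>) (X, Y)"
  shows local_minimizer_rpca_first_order:
      "(A - X ** Y) \<bullet> (P ** Y + X ** Q) = \<gamma> * (X \<bullet> P + Y \<bullet> Q)"
    and local_minimizer_rpca_second_order:
      "2 * ((A - X ** Y) \<bullet> (P ** Q)) \<le>
       (P ** Y + X ** Q) \<bullet> (P ** Y + X ** Q) + \<gamma> * (P \<bullet> P + Q \<bullet> Q)"
proof -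
  define R where "R = A - X ** Y"
  define D where "D = P ** Y + X ** Q"
  define E where "E = P ** Q"
  let ?f = "rpca_objective A \<gamma>"
  let ?p = "\<lambda>t. (X + t *\<^sub>R P, Y + t *\<^sub>R Q)"
  have "(?p \<longlongrightarrow> (X + 0 *\<^sub>R P, Y + 0 *\<^sub>R Q)) (at 0)"
    by (intro tendsto_intros)
  then have "filterlim ?p (nhds (X, Y)) (at 0)" by simp
  then have ev: "\<forall>\<^sub>F t in at 0. ?f (X, Y) \<le> ?f (?p t)"
    using assms unfolding local_minimizer_def filterlim_iff by blast
  have "?f (?p t) - ?f (X, Y) =
      t * (2 * \<gamma> * (X \<bullet> P + Y \<bullet> Q) - 2 * (R \<bullet> D))
      + t^2 * (D \<bullet> D + \<gamma> * (P \<bullet> P + Q \<bullet> Q) - 2 * (R \<bullet> E)) + t^3 * (2 * (D \<bullet> E)) + t^4 * (E \<bullet> E)" for t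
  proof -
    have "(X + t *\<^sub>R P) ** (Y + t *\<^sub>R Q) = X ** Y + (t *\<^sub>R D + t^2 *\<^sub>R E)"
      by (simp add: D_def E_def matrix_mult_bilinear algebra_simps power2_eq_square)
    then have eq: "A - (X + t *\<^sub>R P) ** (Y + t *\<^sub>R Q) = R - t *\<^sub>R D - t^2 *\<^sub>R E"
      by (simp add: R_def)
    show ?thesis
      unfolding rpca_objective_eq_inner R_def[symmetric] eq
      by (simp add: inner_simps inner_commute algebra_simps power_numeral_reduce)
  qed
  with ev have "\<forall>\<^sub>F t in at 0. 0 \<le> t * (2 * \<gamma> * (X \<bullet> P + Y \<bullet> Q) - 2 * (R \<bullet> D))
      + t^2 * (D \<bullet> D + \<gamma> * (P \<bullet> P + Q \<bullet> Q) - 2 * (R \<bullet> E)) + t^3 * (2 * (D \<bullet> E)) + t^4 * (E \<bullet> E)"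
    by (smt (verit, best) eventually_mono)
  from polynomial_nonneg_near_0[OF this]
  show "(A - X ** Y) \<bullet> (P ** Y + X ** Q) = \<gamma> * (X \<bullet> P + Y \<bullet> Q)"
    and "2 * ((A - X ** Y) \<bullet> (P ** Q)) \<le>
       (P ** Y + X ** Q) \<bullet> (P ** Y + X ** Q) + \<gamma> * (P \<bullet> P + Q \<bullet> Q)"
    unfolding R_def D_def E_def by simp_all
qed

section \<open>Stationary points\<close>

text \<open>The partial gradients in \<open>X\<close> and in \<open>Y\<close> vanish; the common
  factor -2 is dropped.\<close>

definition rpca_stationary ::
  "real^'n^'m \<Rightarrow> real \<Rightarrow> real^'k^'m \<Rightarrow> real^'n^'k \<Rightarrow> bool" where
  "rpca_stationary A \<gamma> X Y \<longleftrightarrow>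
     (A - X ** Y) ** transpose Y = \<gamma> *\<^sub>R X \<and> transpose X ** (A - X ** Y) = \<gamma> *\<^sub>R Y"

lemma local_minimizer_imp_stationary:
  assumes "local_minimizer (rpca_objective A \<gamma>) (X, Y)"
  shows "rpca_stationary A \<gamma> X Y"
proof -
  define R where "R = A - X ** Y"
  have "(R ** transpose Y - \<gamma> *\<^sub>R X) \<bullet> P = 0" for P
    using local_minimizer_rpca_first_order[OF assms, of P 0]
    by (simp add: R_def matrix_mult_bilinear inner_diff_left inner_matrix_mult_left)
  moreover have "(transpose X ** R - \<gamma> *\<^sub>R Y) \<bullet> Q = 0" for Q
    using local_minimizer_rpca_first_order[OF assms, of 0 Q]
    by (simp add: R_def matrix_mult_bilinear inner_diff_left inner_matrix_mult_right)
  ultimately show ?thesis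
    unfolding rpca_stationary_def R_def[symmetric] by (metis inner_eq_zero_iff right_minus_eq)
qed

text \<open>Both sides equal \<open>X\<^sup>T R Y\<^sup>T\<close> for the residual \<open>R\<close>,
  bracketed in the two possible ways. For \<gamma> = 0 this carries no information, which is why
  that case is treated separately later.\<close>

lemma stationary_gram:
  assumes "rpca_stationary A \<gamma> X Y"
  shows "\<gamma> *\<^sub>R (transpose X ** X) = \<gamma> *\<^sub>R (Y ** transpose Y)"
proof -
  have "transpose X ** ((A - X ** Y) ** transpose Y) = (transpose X ** (A - X ** Y)) ** transpose Y"
    by (simp add: matrix_mul_assoc)
  then show ?thesis
    using assms unfolding rpca_stationary_def by (metis matrix_mult_bilinear(5,6))
qed

text \<open>Pair the first stationarity equation with \<open>X\<close> and the second with
  \<open>Y\<close>, moving the other factor across by adjointness.\<close>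

lemma stationary_value:
  assumes "rpca_stationary A \<gamma> X Y"
  shows "\<gamma> * (X \<bullet> X) = (A - X ** Y) \<bullet> (X ** Y)" "\<gamma> * (Y \<bullet> Y) = (A - X ** Y) \<bullet> (X ** Y)"
  using assms
  by (simp add: rpca_stationary_def inner_matrix_mult_left[of "A - X ** Y" X Y],
      simp add: rpca_stationary_def inner_matrix_mult_right[of "A - X ** Y" X Y])


lemma stationary_gram_eq:
  assumes "rpca_stationary A \<gamma> X Y" "\<gamma> > 0"
  shows "transpose X ** X = Y ** transpose Y"
  using stationary_gram[OF assms(1)] assms(2) by simp

section \<open>Singular value decomposition with simple nonzero singular values\<close>

locale svd =
  fixes A :: "real^'n^'m" and r :: nat and u :: "nat \<Rightarrow> real^'m" and \<sigma> :: "nat \<Rightarrow> real"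
    and v :: "nat \<Rightarrow> real^'n"
  assumes is_svd: "is_svd A r u \<sigma> v" and inj: "inj_on \<sigma> {..<r}"
begin

lemma sigma_pos: "i < r \<Longrightarrow> \<sigma> i > 0"
  and u_orthonormal: "i < r \<Longrightarrow> j < r \<Longrightarrow> u i \<bullet> u j = (if i = j then 1 else 0)"
  and v_orthonormal: "i < r \<Longrightarrow> j < r \<Longrightarrow> v i \<bullet> v j = (if i = j then 1 else 0)"
  using is_svd unfolding is_svd_def by blast+

text \<open>No positive part is taken and \<open>I\<close> is arbitrary: a stationary point may drop
  any of the singular triples, and the condition \<open>\<sigma> i > \<gamma>\<close> is imposed on
  \<open>I\<close> where it is wanted.\<close>

definition soft_threshold :: "real \<Rightarrow> nat set \<Rightarrow> real^'n^'m" where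
  "soft_threshold \<gamma> I = (\<Sum>i\<in>I. (\<sigma> i - \<gamma>) *\<^sub>R outer (u i) (v i))"

lemma soft_threshold_mult:
  "soft_threshold \<gamma> I *v y = (\<Sum>i\<in>I. ((\<sigma> i - \<gamma>) * (v i \<bullet> y)) *\<^sub>R u i)"
  unfolding soft_threshold_def
  by (induction I rule: infinite_finite_induct)
    (simp_all only: sum.infinite sum.empty sum.insert matrix_vector_mult_0 simp_thms
      matrix_vector_mult_add_rdistrib scaleR_outer_matrix_vector_mult)

lemma transpose_soft_threshold_mult:
  "transpose (soft_threshold \<gamma> I) *v z = (\<Sum>i\<in>I. ((\<sigma> i - \<gamma>) * (u i \<bullet> z)) *\<^sub>R v i)"
proof (rule vector_eq_ldot[THEN iffD1], rule allI)
  fix y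
  show "y \<bullet> (transpose (soft_threshold \<gamma> I) *v z)
      = y \<bullet> (\<Sum>i\<in>I. ((\<sigma> i - \<gamma>) * (u i \<bullet> z)) *\<^sub>R v i)"
    unfolding inner_transpose_vector soft_threshold_mult inner_sum_left inner_sum_right
    by (rule sum.cong) (simp_all add: inner_commute[of y])
qed

lemma A_eq_soft_threshold: "A = soft_threshold 0 {..<r}"
proof -
  have "A = (\<chi> a b. \<Sum>i<r. \<sigma> i * u i $ a * v i $ b)"
    using is_svd unfolding is_svd_def by blast
  also have "\<dots> = soft_threshold 0 {..<r}"
    by (simp add: soft_threshold_def outer_def vec_eq_iff mult.assoc)
  finally show ?thesis .
qed

lemmas A_mult = soft_threshold_mult[of 0 "{..<r}", folded A_eq_soft_threshold]
  and At_mult = transpose_soft_threshold_mult[of 0 "{..<r}", folded A_eq_soft_threshold]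

lemma A_v: "A *v v j = \<sigma> j *\<^sub>R u j"
  and At_u: "transpose A *v u j = \<sigma> j *\<^sub>R v j" if "j < r"
proof -
  have "(\<Sum>i<r. (\<sigma> i * (v i \<bullet> v j)) *\<^sub>R u i) = (\<Sum>i<r. if i = j then \<sigma> j *\<^sub>R u j else 0)"
    "(\<Sum>i<r. (\<sigma> i * (u i \<bullet> u j)) *\<^sub>R v i) = (\<Sum>i<r. if i = j then \<sigma> j *\<^sub>R v j else 0)"
    by (rule sum.cong; use that in \<open>simp add: v_orthonormal u_orthonormal\<close>)+
  then show "A *v v j = \<sigma> j *\<^sub>R u j" "transpose A *v u j = \<sigma> j *\<^sub>R v j"
    unfolding A_mult At_mult using that by simp_all
qed

text \<open>Since \<open>(\<sigma> j)\<^sup>2\<close> differs from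
  \<open>(\<sigma> i)\<^sup>2\<close>, the symmetric matrix \<open>A A\<^sup>T\<close> forces
  \<open>h\<close> to be orthogonal to every other \<open>u j\<close>. Then
  \<open>A A\<^sup>T h\<close> is a multiple of \<open>u i\<close>, and dividing by the positive
  eigenvalue gives the same for \<open>h\<close>.\<close>

lemma eigenvector_AAt:
  assumes i: "i < r" and h: "A *v (transpose A *v h) = (\<sigma> i)\<^sup>2 *\<^sub>R h"
  shows "h = (u i \<bullet> h) *\<^sub>R u i"
proof -
  have 0: "u j \<bullet> h = 0" if j: "j < r" "j \<noteq> i" for j
  proof -
    have "u j \<bullet> (A *v (transpose A *v h)) = (\<sigma> j)\<^sup>2 * (u j \<bullet> h)"
      using j(1) by (simp add: inner_matrix_vector[of "u j"] At_u inner_transpose_vector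
          matrix_vector_mult_scaleR A_v power2_eq_square)
    with h have "(\<sigma> j)\<^sup>2 * (u j \<bullet> h) = (\<sigma> i)\<^sup>2 * (u j \<bullet> h)"
      by (metis inner_scaleR_right)
    moreover have "\<sigma> j \<noteq> \<sigma> i" using inj i j by (auto simp: inj_on_def)
    ultimately show ?thesis
      using sigma_pos[OF i] sigma_pos[OF j(1)] by (simp add: power2_eq_iff)
  qed
  have "transpose A *v h = (\<Sum>j<r. if j = i then (\<sigma> i * (u i \<bullet> h)) *\<^sub>R v i else 0)"
    unfolding At_mult by (intro sum.cong) (auto simp: 0)
  also have "\<dots> = (\<sigma> i * (u i \<bullet> h)) *\<^sub>R v i" using i by simp
  finally have "A *v (transpose A *v h) = (\<sigma> i)\<^sup>2 *\<^sub>R ((u i \<bullet> h) *\<^sub>R u i)"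
    using i by (simp add: matrix_vector_mult_scaleR A_v power2_eq_square mult_ac)
  with h have "(\<sigma> i)\<^sup>2 *\<^sub>R h = (\<sigma> i)\<^sup>2 *\<^sub>R ((u i \<bullet> h) *\<^sub>R u i)" by metis
  then show ?thesis using sigma_pos[OF i] by (simp del: scaleR_scaleR)
qed

text \<open>If \<open>K\<close> and \<open>K A A\<^sup>T\<close> are symmetric, then
  \<open>K\<close> commutes with \<open>A A\<^sup>T\<close>, so it maps the one-dimensional
  eigenspace spanned by \<open>u i\<close> into itself.\<close>

lemma eigenvector_commuting:
  assumes i: "i < r" and K: "transpose K = K"
    and comm: "transpose (K ** (A ** transpose A)) = K ** (A ** transpose A)"
  shows "K *v u i = (u i \<bullet> (K *v u i)) *\<^sub>R u i"
proof (rule eigenvector_AAt[OF i])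
  have "A *v (transpose A *v (K *v u i)) = transpose (K ** (A ** transpose A)) *v u i"
    by (simp add: K matrix_transpose_mul matrix_vector_mul_assoc matrix_mul_assoc)
  also have "\<dots> = K *v (A *v (transpose A *v u i))"
    by (simp add: comm matrix_vector_mul_assoc)
  also have "\<dots> = (\<sigma> i)\<^sup>2 *\<^sub>R (K *v u i)"
    using i by (simp add: At_u A_v matrix_vector_mult_scaleR power2_eq_square)
  finally show "A *v (transpose A *v (K *v u i)) = (\<sigma> i)\<^sup>2 *\<^sub>R (K *v u i)" .
qed

text \<open>\<open>M\<^sup>T\<close> is determined by its values on the \<open>u i\<close> and on
  their orthogonal complement, which lies in the kernel of \<open>A\<^sup>T\<close>. The support
  consists of the \<open>u i\<close> that \<open>M\<^sup>T\<close> does not annihilate.\<close>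

lemma soft_thresholdI:
  assumes u: "\<And>i. i < r \<Longrightarrow>
      transpose M *v u i = 0 \<or> \<sigma> i > \<gamma> \<and> transpose M *v u i = (\<sigma> i - \<gamma>) *\<^sub>R v i"
    and ker: "\<And>z. transpose A *v z = 0 \<Longrightarrow> transpose M *v z = 0"
  shows "\<exists>I\<subseteq>{..<r}. (\<forall>i\<in>I. \<sigma> i > \<gamma>) \<and> M = soft_threshold \<gamma> I"
proof (intro exI conjI)
  let ?I = "{i. i < r \<and> transpose M *v u i \<noteq> 0}"
  show "?I \<subseteq> {..<r}" by auto
  show "\<forall>i\<in>?I. \<sigma> i > \<gamma>" using u by blast
  have "transpose M *v z = transpose (soft_threshold \<gamma> ?I) *v z" for z
  proof -
    \<comment> \<open>The component of \<open>z\<close> orthogonal to all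
      \<open>u i\<close>.\<close>
    define z' where "z' = z - (\<Sum>i<r. (u i \<bullet> z) *\<^sub>R u i)"
    have z: "z = z' + (\<Sum>i<r. (u i \<bullet> z) *\<^sub>R u i)" by (simp add: z'_def)
    have "u j \<bullet> z' = 0" if "j < r" for j
    proof -
      have "(\<Sum>i<r. (u i \<bullet> z) * (u j \<bullet> u i)) = (\<Sum>i<r. if i = j then u j \<bullet> z else 0)"
        using that by (intro sum.cong) (auto simp: u_orthonormal)
      then show ?thesis using that by (simp add: z'_def inner_diff_right inner_sum_right)
    qed
    then have "transpose A *v z' = 0" by (simp add: At_mult)
    then have "transpose M *v z' = 0" by (rule ker)
    then have "transpose M *v z = transpose M *v (\<Sum>i<r. (u i \<bullet> z) *\<^sub>R u i)"
      by (metis z matrix_vector_right_distrib add_0_left)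
    also have "\<dots> = (\<Sum>i<r. (u i \<bullet> z) *\<^sub>R (transpose M *v u i))"
      by (simp only: linear_sum[OF matrix_vector_mul_linear] matrix_vector_mult_scaleR)
    also have "\<dots> = (\<Sum>i\<in>?I. (u i \<bullet> z) *\<^sub>R (transpose M *v u i))"
      by (rule sum.mono_neutral_right) auto
    also have "\<dots> = (\<Sum>i\<in>?I. ((\<sigma> i - \<gamma>) * (u i \<bullet> z)) *\<^sub>R v i)"
    proof (rule sum.cong[OF refl])
      fix i assume "i \<in> ?I"
      then have "transpose M *v u i = (\<sigma> i - \<gamma>) *\<^sub>R v i" using u by blast
      then show "(u i \<bullet> z) *\<^sub>R (transpose M *v u i) = ((\<sigma> i - \<gamma>) * (u i \<bullet> z)) *\<^sub>R v i"
        by (simp add: mult.commute)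
    qed
    also have "\<dots> = transpose (soft_threshold \<gamma> ?I) *v z"
      by (rule transpose_soft_threshold_mult[symmetric])
    finally show ?thesis .
  qed
  then have "transpose M = transpose (soft_threshold \<gamma> ?I)"
    by (intro matrix_eq[THEN iffD2] allI)
  then show "M = soft_threshold \<gamma> ?I" by simp
qed

section \<open>The product of the factors at a stationary point\<close>

text \<open>Balancedness turns stationarity into \<open>A Y\<^sup>T = N\<close> with
  \<open>N = X (G + \<gamma>)\<close>, and \<open>K A A\<^sup>T = N N\<^sup>T\<close> is symmetric.
  Hence each \<open>u i\<close> is an eigenvector of \<open>K = X X\<^sup>T\<close>, and its
  eigenvalue \<kappa> is either 0 or \<open>\<sigma> i - \<gamma>\<close>.\<close>

lemma stationary_imp_soft_threshold_pos:
  fixes X :: "real^'k^'m" and Y :: "real^'n^'k"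
  assumes st: "rpca_stationary A \<gamma> X Y" and \<gamma>: "\<gamma> > 0"
  shows "\<exists>I\<subseteq>{..<r}. (\<forall>i\<in>I. \<sigma> i > \<gamma>) \<and> X ** Y = soft_threshold \<gamma> I"
proof (rule soft_thresholdI)
  define G where "G = transpose X ** X"
  define K where "K = X ** transpose X"
  define N where "N = X ** G + \<gamma> *\<^sub>R X"
  have GY: "G = Y ** transpose Y" using stationary_gram_eq[OF assms] by (simp add: G_def)
  have G: "transpose G = G" by (simp add: G_def matrix_transpose_mul)
  have AY: "A ** transpose Y = N" and XA: "transpose X ** A = G ** Y + \<gamma> *\<^sub>R Y"
    using st unfolding rpca_stationary_def N_def
    by (simp_all add: matrix_mult_bilinear diff_eq_eq GY matrix_mul_assoc)
      (simp_all add: GY[symmetric] G_def algebra_simps)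
  have YA: "Y ** transpose A = transpose N"
    unfolding AY[symmetric] by (simp add: matrix_transpose_mul)
  have KA: "K ** (A ** transpose A) = N ** transpose N"
  proof -
    have "K ** (A ** transpose A) = X ** (transpose X ** A) ** transpose A"
      by (simp add: K_def matrix_mul_assoc)
    also have "\<dots> = N ** (Y ** transpose A)"
      by (simp add: XA N_def matrix_mult_bilinear matrix_mul_assoc)
    finally show ?thesis by (simp add: YA)
  qed
  have Nt: "transpose N *v z = G *v (transpose X *v z) + \<gamma> *\<^sub>R (transpose X *v z)" for z
    by (simp add: N_def transpose_add transpose_scalar matrix_transpose_mul G
        matrix_vector_mult_add_rdistrib matrix_vector_mul_assoc scaleR_matrix_vector_assoc)
  have Mt: "transpose (X ** Y) *v z = transpose Y *v (transpose X *v z)" for z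
    by (simp add: matrix_transpose_mul matrix_vector_mul_assoc)
  show "transpose (X ** Y) *v z = 0" if "transpose A *v z = 0" for z
  proof -
    let ?x = "transpose X *v z"
    have "N *v (transpose N *v z) = K *v (A *v (transpose A *v z))"
      by (simp add: KA matrix_vector_mul_assoc)
    then have "transpose N *v z = 0"
      using that by (metis inner_eq_zero_iff inner_transpose_vector inner_zero_left matrix_vector_mult_0_right)
    \<comment> \<open>Pair \<open>N\<^sup>T z = 0\<close> with \<open>?x\<close>. As
      \<open>G\<close> is positive semidefinite, both summands are nonnegative, and \<gamma> > 0
      leaves only \<open>?x = 0\<close>.\<close>
    then have "?x \<bullet> (G *v ?x) + \<gamma> * (?x \<bullet> ?x) = 0"
      by (metis Nt inner_add_right inner_scaleR_right inner_zero_right)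
    moreover have "?x \<bullet> (G *v ?x) = (X *v ?x) \<bullet> (X *v ?x)"
      by (simp add: G_def inner_transpose_vector flip: matrix_vector_mul_assoc)
    ultimately have "?x \<bullet> ?x = 0"
      using \<gamma> by (smt (verit) inner_ge_zero mult_pos_pos)
    then show ?thesis by (simp add: Mt)
  qed
  show "transpose (X ** Y) *v u i = 0 \<or>
    \<sigma> i > \<gamma> \<and> transpose (X ** Y) *v u i = (\<sigma> i - \<gamma>) *\<^sub>R v i" if i: "i < r" for i
  proof -
    define x where "x = transpose X *v u i"
    define \<kappa> where "\<kappa> = x \<bullet> x"
    have Ku: "K *v u i = \<kappa> *\<^sub>R u i"
    proof -
      have "u i \<bullet> (K *v u i) = \<kappa>"
        by (simp add: K_def \<kappa>_def x_def inner_transpose_vector inner_commute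
            flip: matrix_vector_mul_assoc)
      moreover have "K *v u i = (u i \<bullet> (K *v u i)) *\<^sub>R u i"
        by (rule eigenvector_commuting[OF i]) (simp add: K_def matrix_transpose_mul,
            simp add: KA matrix_transpose_mul)
      ultimately show ?thesis by simp
    qed
    have Gx: "G *v x = \<kappa> *\<^sub>R x"
      using Ku by (simp add: G_def K_def x_def matrix_vector_mult_scaleR flip: matrix_vector_mul_assoc)
    have Nu: "transpose N *v u i = (\<kappa> + \<gamma>) *\<^sub>R x"
      using Gx Nt[of "u i"] by (simp add: x_def scaleR_add_left)
    \<comment> \<open>The squared norm of \<open>N\<^sup>T u i\<close> is computed in two ways, from
      \<open>K A A\<^sup>T\<close> and from \<open>Nu\<close>; this is the equation for
      \<kappa>.\<close>
    have "u i \<bullet> (N *v (transpose N *v u i)) = u i \<bullet> (K *v (A *v (transpose A *v u i)))"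
      by (simp add: KA matrix_vector_mul_assoc)
    also have "\<dots> = \<kappa> * (\<sigma> i)\<^sup>2"
      using i by (simp add: At_u A_v matrix_vector_mult_scaleR Ku u_orthonormal power2_eq_square)
    finally have "(transpose N *v u i) \<bullet> (transpose N *v u i) = \<kappa> * (\<sigma> i)\<^sup>2"
      by (metis inner_commute inner_transpose_vector)
    then have "\<kappa> * (\<kappa> + \<gamma>)\<^sup>2 = \<kappa> * (\<sigma> i)\<^sup>2"
      unfolding Nu by (simp add: \<kappa>_def power2_eq_square mult_ac)
    show ?thesis
    proof (cases "\<kappa> = 0")
      case True
      then show ?thesis by (simp add: Mt \<kappa>_def x_def[symmetric])
    next
      case False
      then have "\<kappa> > 0" by (simp add: \<kappa>_def)
      with \<open>\<kappa> * (\<kappa> + \<gamma>)\<^sup>2 = _\<close> have s: "\<sigma> i = \<kappa> + \<gamma>"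
        using \<gamma> sigma_pos[OF i] by (simp add: power2_eq_iff)
      \<comment> \<open>To find \<open>Y\<^sup>T x\<close>, evaluate \<open>A\<^sup>T X x\<close>
        once through the singular pair and once through the stationarity equation
        \<open>XA\<close>.\<close>
      have "transpose (transpose X ** A) *v x = transpose A *v (X *v x)"
        by (simp add: matrix_transpose_mul matrix_vector_mul_assoc)
      also have "X *v x = \<kappa> *\<^sub>R u i"
        using Ku by (simp add: x_def K_def flip: matrix_vector_mul_assoc)
      finally have "\<kappa> *\<^sub>R (\<sigma> i *\<^sub>R v i) = transpose (transpose X ** A) *v x"
        using i by (simp add: matrix_vector_mult_scaleR At_u)
      also have "\<dots> = (\<kappa> + \<gamma>) *\<^sub>R (transpose Y *v x)"
        by (simp add: XA transpose_add transpose_scalar matrix_transpose_mul G Gx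
            matrix_vector_mult_add_rdistrib scaleR_add_left matrix_vector_mult_scaleR
            flip: matrix_vector_mul_assoc scaleR_matrix_vector_assoc)
      finally have "\<sigma> i *\<^sub>R (\<kappa> *\<^sub>R v i) = \<sigma> i *\<^sub>R (transpose Y *v x)"
        by (simp add: s mult_ac)
      then have "transpose Y *v x = \<kappa> *\<^sub>R v i"
        using sigma_pos[OF i] by (simp del: scaleR_scaleR)
      then show ?thesis using s \<open>\<kappa> > 0\<close> by (simp add: Mt x_def)
    qed
  qed
qed

text \<open>Without regularization the factors need not be balanced, so the argument runs on
  \<open>M = X Y\<close> itself: \<open>A M\<^sup>T = M M\<^sup>T\<close> and
  \<open>M\<^sup>T A = M\<^sup>T M\<close> give \<open>K A A\<^sup>T = K K\<close> for
  \<open>K = M M\<^sup>T\<close>, and the eigenvalue at \<open>u i\<close> is 0 or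
  \<open>(\<sigma> i)\<^sup>2\<close>.\<close>

lemma stationary_imp_soft_threshold_zero:
  fixes X :: "real^'k^'m" and Y :: "real^'n^'k"
  assumes st: "rpca_stationary A 0 X Y"
  shows "\<exists>I\<subseteq>{..<r}. (\<forall>i\<in>I. \<sigma> i > 0) \<and> X ** Y = soft_threshold 0 I"
proof (rule soft_thresholdI)
  define M where "M = X ** Y"
  define K where "K = M ** transpose M"
  have "(A - M) ** transpose Y = 0" "transpose X ** (A - M) = 0"
    using st by (simp_all add: rpca_stationary_def M_def)
  then have "(A - M) ** transpose M = 0" "transpose M ** (A - M) = 0"
    unfolding M_def matrix_transpose_mul by (metis matrix_mul_assoc matrix_mult_bilinear(7,8))+
  then have AM: "A ** transpose M = K" and MA: "transpose M ** A = transpose M ** M"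
    by (simp_all add: K_def matrix_mult_bilinear)
  have K: "transpose K = K" by (simp add: K_def matrix_transpose_mul)
  have MAt: "M ** transpose A = K" using AM K by (metis matrix_transpose_mul transpose_transpose)
  have KA: "K ** (A ** transpose A) = K ** K"
    by (metis K_def MA MAt matrix_mul_assoc)
  have ker: "transpose M *v z = 0" if "K *v z = 0" for z
    using that unfolding K_def
    by (metis inner_eq_zero_iff inner_transpose_vector inner_zero_left matrix_vector_mul_assoc)
  show "transpose (X ** Y) *v z = 0" if "transpose A *v z = 0" for z
  proof -
    have "K *v (K *v z) = 0" using that KA by (metis matrix_vector_mul_assoc matrix_vector_mult_0_right)
    then have "K *v z = 0" by (metis K inner_eq_zero_iff inner_transpose_vector inner_zero_left)
    then show ?thesis using ker M_def by blast
  qed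
  show "transpose (X ** Y) *v u i = 0 \<or>
    \<sigma> i > 0 \<and> transpose (X ** Y) *v u i = (\<sigma> i - 0) *\<^sub>R v i" if i: "i < r" for i
  proof -
    define \<kappa> where "\<kappa> = u i \<bullet> (K *v u i)"
    have Ku: "K *v u i = \<kappa> *\<^sub>R u i" unfolding \<kappa>_def
      by (rule eigenvector_commuting[OF i K]) (simp add: KA K matrix_transpose_mul)
    have "K *v (K *v u i) = K *v (A *v (transpose A *v u i))"
      by (simp add: KA matrix_vector_mul_assoc)
    then have "u i \<bullet> (K *v (K *v u i)) = u i \<bullet> (K *v (A *v (transpose A *v u i)))" by simp
    then have "\<kappa> * \<kappa> = \<kappa> * (\<sigma> i)\<^sup>2"
      using i by (simp add: At_u A_v matrix_vector_mult_scaleR Ku u_orthonormal power2_eq_square)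
    show ?thesis
    proof (cases "\<kappa> = 0")
      case True
      then show ?thesis using ker Ku M_def by simp
    next
      case False
      then have \<kappa>: "\<kappa> = (\<sigma> i)\<^sup>2" using \<open>\<kappa> * \<kappa> = _\<close> by simp
      have "\<sigma> i *\<^sub>R (M *v v i) = \<sigma> i *\<^sub>R (\<sigma> i *\<^sub>R u i)"
        using Ku i unfolding MAt[symmetric] \<kappa>
        by (simp add: At_u matrix_vector_mult_scaleR power2_eq_square flip: matrix_vector_mul_assoc)
      then have Mv: "M *v v i = \<sigma> i *\<^sub>R u i"
        using sigma_pos[OF i] by (simp del: scaleR_scaleR)
      let ?w = "transpose M *v u i"
      have "?w \<bullet> ?w = (\<sigma> i)\<^sup>2"
        using \<kappa> unfolding \<kappa>_def K_def
        by (metis inner_commute inner_transpose_vector matrix_vector_mul_assoc)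
      moreover have "v i \<bullet> ?w = \<sigma> i"
        using i by (simp add: inner_transpose_vector Mv u_orthonormal)
      \<comment> \<open>Equality case of Cauchy-Schwarz: \<open>?w\<close> has norm
        \<open>\<sigma> i\<close> and inner product \<open>\<sigma> i\<close> with the unit vector
        \<open>v i\<close>.\<close>
      ultimately have "(?w - \<sigma> i *\<^sub>R v i) \<bullet> (?w - \<sigma> i *\<^sub>R v i) = 0"
        using i by (simp add: inner_simps inner_commute v_orthonormal power2_eq_square)
      then show ?thesis using sigma_pos[OF i] by (simp add: M_def)
    qed
  qed
qed

section \<open>Rank constraints on the support\<close>

lemma soft_threshold_v:
  assumes "I \<subseteq> {..<r}" "j < r"
  shows "soft_threshold \<gamma> I *v v j = (if j \<in> I then (\<sigma> j - \<gamma>) *\<^sub>R u j else 0)"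
    and "transpose (soft_threshold \<gamma> I) *v u j = (if j \<in> I then (\<sigma> j - \<gamma>) *\<^sub>R v j else 0)"
proof -
  have fin: "finite I" using assms(1) finite_subset by blast
  have "(\<Sum>i\<in>I. ((\<sigma> i - \<gamma>) * (v i \<bullet> v j)) *\<^sub>R u i) = (\<Sum>i\<in>I. if i = j then (\<sigma> j - \<gamma>) *\<^sub>R u j else 0)"
    using assms by (intro sum.cong) (auto simp: v_orthonormal)
  then show "soft_threshold \<gamma> I *v v j = (if j \<in> I then (\<sigma> j - \<gamma>) *\<^sub>R u j else 0)"
    unfolding soft_threshold_mult using fin by simp
  have "(\<Sum>i\<in>I. ((\<sigma> i - \<gamma>) * (u i \<bullet> u j)) *\<^sub>R v i) = (\<Sum>i\<in>I. if i = j then (\<sigma> j - \<gamma>) *\<^sub>R v j else 0)"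
    using assms by (intro sum.cong) (auto simp: u_orthonormal)
  then show "transpose (soft_threshold \<gamma> I) *v u j = (if j \<in> I then (\<sigma> j - \<gamma>) *\<^sub>R v j else 0)"
    unfolding transpose_soft_threshold_mult using fin by simp
qed

text \<open>Each kept \<open>u i\<close> is the image under \<open>X\<close> of a multiple of
  \<open>Y v i\<close>, and orthonormal vectors in the range of \<open>X\<close> number at most
  \<open>CARD('k)\<close>.\<close>

lemma card_soft_threshold_le:
  fixes X :: "real^'k^'m" and Y :: "real^'n^'k"
  assumes I: "I \<subseteq> {..<r}" "\<And>i. i \<in> I \<Longrightarrow> \<sigma> i > \<gamma>" and M: "X ** Y = soft_threshold \<gamma> I"
  shows "card I \<le> CARD('k)"
proof -
  have "u i \<in> range ((*v) X)" if "i \<in> I" for i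
  proof
    have "X *v (Y *v v i) = (\<sigma> i - \<gamma>) *\<^sub>R u i"
      using soft_threshold_v(1)[OF I(1), of i] that I by (auto simp: matrix_vector_mul_assoc M)
    then show "u i = X *v ((1 / (\<sigma> i - \<gamma>)) *\<^sub>R (Y *v v i))"
      using I(2)[OF that] by (simp add: matrix_vector_mult_scaleR)
  qed auto
  then have "u ` I \<subseteq> range ((*v) X)" by auto
  then have "dim (u ` I) \<le> dim (range ((*v) X))" by (rule dim_subset)
  also have "\<dots> \<le> dim (UNIV :: (real^'k) set)" by (rule dim_image_le) simp
  finally have dim: "dim (u ` I) \<le> CARD('k)" by simp
  have inj: "inj_on u I"
  proof
    fix i j assume "i \<in> I" "j \<in> I" and eq: "u i = u j"
    then have "i < r" "j < r" using I(1) by auto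
    then have "(if i = j then 1 else 0) = (1::real)"
      using u_orthonormal[of i j] u_orthonormal[of j j] eq by simp
    then show "i = j" by (simp split: if_splits)
  qed
  have "independent (u ` I)"
  proof (rule pairwise_orthogonal_independent)
    show "pairwise orthogonal (u ` I)"
      using I(1) unfolding pairwise_def orthogonal_def
      by (auto simp: u_orthonormal subset_iff split: if_splits)
    show "0 \<notin> u ` I" using I(1) u_orthonormal by (metis imageE inner_zero_left lessThan_iff subsetD zero_neq_one)
  qed
  then have "dim (u ` I) = card (u ` I)" by (rule dim_eq_card_independent)
  with dim show ?thesis using card_image[OF inj] by simp
qed

text \<open>If \<open>Y\<^sup>T\<close> is injective, then \<open>Y\<close> has a right inverse and
  the range of \<open>X\<close> lies in the span of the kept \<open>u i\<close>. As these are fewer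
  than \<open>CARD('k)\<close>, some nonzero \<open>w\<close> is orthogonal to all
  \<open>X\<^sup>T u i\<close>; then \<open>X w\<close> lies in that span and is orthogonal to it,
  hence 0.\<close>

lemma rank_deficient_unit_vector:
  fixes X :: "real^'k^'m" and Y :: "real^'n^'k"
  assumes I: "I \<subseteq> {..<r}" and M: "X ** Y = soft_threshold \<gamma> I" and card: "card I < CARD('k)"
  obtains w where "w \<bullet> w = 1" "X *v w = 0 \<or> transpose Y *v w = 0"
proof -
  have "\<exists>w. w \<noteq> 0 \<and> (X *v w = 0 \<or> transpose Y *v w = 0)"
  proof (cases "\<forall>w. transpose Y *v w = 0 \<longrightarrow> w = 0")
    case True
    then obtain B where "B ** transpose Y = mat 1"
      using matrix_left_invertible_ker[of "transpose Y"] by blast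
    then have B: "Y ** transpose B = mat 1"
      by (metis matrix_transpose_mul transpose_mat transpose_transpose)
    have fin: "finite I" using I finite_subset by blast
    have "dim ((\<lambda>i. transpose X *v u i) ` I) \<le> card I"
      using fin by (meson card_image_le dim_le_card' finite_imageI le_trans)
    with card have "dim ((\<lambda>i. transpose X *v u i) ` I) < DIM(real^'k)" by simp
    then obtain w where w: "w \<noteq> 0"
      "\<And>y. y \<in> span ((\<lambda>i. transpose X *v u i) ` I) \<Longrightarrow> orthogonal w y"
      by (rule orthogonal_to_subspace_exists) blast
    have u: "u i \<bullet> (X *v w) = 0" if "i \<in> I" for i
      using w(2)[of "transpose X *v u i"] that
      by (simp add: span_base orthogonal_def inner_transpose_vector inner_commute)
    have "X *v w = soft_threshold \<gamma> I *v (transpose B *v w)"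
    proof -
      have "X *v w = X *v ((Y ** transpose B) *v w)" by (simp add: B)
      also have "\<dots> = (X ** Y) *v (transpose B *v w)"
        by (simp only: matrix_vector_mul_assoc matrix_mul_assoc)
      finally show ?thesis by (simp only: M)
    qed
    then have "(X *v w) \<bullet> (X *v w)
        = (\<Sum>i\<in>I. ((\<sigma> i - \<gamma>) * (v i \<bullet> (transpose B *v w))) *\<^sub>R u i) \<bullet> (X *v w)"
      by (simp only: soft_threshold_mult)
    also have "\<dots> = 0" by (simp add: inner_sum_left u)
    finally have "(X *v w) \<bullet> (X *v w) = 0" .
    with w(1) show ?thesis by auto
  qed blast
  then obtain w where w: "w \<noteq> 0" "X *v w = 0 \<or> transpose Y *v w = 0" by blast
  show ?thesis
  proof
    show "(w /\<^sub>R norm w) \<bullet> (w /\<^sub>R norm w) = 1"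
      using w(1) by (simp add: dot_square_norm power2_eq_square)
    show "X *v (w /\<^sub>R norm w) = 0 \<or> transpose Y *v (w /\<^sub>R norm w) = 0"
      using w(2) by (auto simp: matrix_vector_mult_scaleR)
  qed
qed

section \<open>Second-order conditions on the support\<close>

context
  fixes X :: "real^'k^'m" and Y :: "real^'n^'k" and \<gamma> :: real and I :: "nat set" and j :: nat
  assumes min: "local_minimizer (rpca_objective A \<gamma>) (X, Y)" and nonneg: "\<gamma> \<ge> 0"
    and I: "I \<subseteq> {..<r}" and gt: "\<And>i. i \<in> I \<Longrightarrow> \<sigma> i > \<gamma>" and M: "X ** Y = soft_threshold \<gamma> I"
    and j: "j < r" "j \<notin> I"
begin

text \<open>The pair \<open>j\<close> is absent from \<open>X Y\<close> and so survives in the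
  residual. This makes \<open>\<sigma> j\<close> appear in the term
  \<open>R \<bullet> (P ** Q)\<close> of the second-order condition.\<close>

lemma residual_v: "(A - X ** Y) *v v j = \<sigma> j *\<^sub>R u j"
  using j by (simp add: M soft_threshold_v[OF I] matrix_vector_mult_diff_rdistrib A_v)

text \<open>
  A direction \<open>w\<close> in the kernel of \<open>X\<close> or \<open>Y\<^sup>T\<close> is free to carry a multiple of \<open>u j (v j)\<^sup>T\<close>. For
  \<open>\<gamma> = 0\<close> only one of the two kernels is available, so the two factors must be scaled differently.
\<close>

lemma discarded_le_of_rank_deficient:
  assumes "card I < CARD('k)"
  shows "\<sigma> j \<le> \<gamma>"
proof -
  obtain w where w: "w \<bullet> w = 1" "X *v w = 0 \<or> transpose Y *v w = 0"
    by (rule rank_deficient_unit_vector[OF I M assms])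
  define R where "R = A - X ** Y"
  define x where "x = X *v w"
  define y where "y = transpose Y *v w"
  have st: "R ** transpose Y = \<gamma> *\<^sub>R X" "transpose X ** R = \<gamma> *\<^sub>R Y"
    using local_minimizer_imp_stationary[OF min] by (simp_all add: rpca_stationary_def R_def)
  have "R *v y = \<gamma> *\<^sub>R x"
    by (simp add: y_def x_def matrix_vector_mul_assoc st scaleR_matrix_vector_assoc)
  moreover have "transpose R *v x = \<gamma> *\<^sub>R y"
  proof -
    have "transpose R *v x = transpose (transpose X ** R) *v w"
      by (simp add: x_def matrix_vector_mul_assoc matrix_transpose_mul)
    then show ?thesis by (simp add: st transpose_scalar y_def scaleR_matrix_vector_assoc)
  qed
  \<comment> \<open>One of \<open>x\<close>, \<open>y\<close> vanishes by the choice of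
    \<open>w\<close>; for \<gamma> > 0 the two relations just shown carry this over to the
    other.\<close>
  ultimately have xy: "x = 0 \<and> (\<gamma> = 0 \<or> y = 0) \<or> y = 0 \<and> (\<gamma> = 0 \<or> x = 0)"
    using w(2) by (auto simp: x_def[symmetric] y_def[symmetric])
  \<comment> \<open>Second-order condition for \<open>P = s u j w\<^sup>T\<close> and
    \<open>Q = t w (v j)\<^sup>T\<close>; the cross term drops out because \<open>x\<close> or
    \<open>y\<close> is 0.\<close>
  have so: "2 * (s * t * \<sigma> j) \<le> s\<^sup>2 * (y \<bullet> y) + t\<^sup>2 * (x \<bullet> x) + \<gamma> * (s\<^sup>2 + t\<^sup>2)" for s t
  proof -
    let ?P = "outer (s *\<^sub>R u j) w" and ?Q = "outer w (t *\<^sub>R v j)"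
    have "?P ** Y = s *\<^sub>R outer (u j) y" "X ** ?Q = t *\<^sub>R outer x (v j)"
      by (simp_all add: matrix_mult_outer outer_matrix_mult matrix_mult_bilinear x_def y_def)
    moreover have "R \<bullet> (?P ** ?Q) = s * t * \<sigma> j"
      using residual_v j w(1)
      by (simp add: matrix_mult_outer outer_matrix_vector_mult inner_outer R_def u_orthonormal
          matrix_mult_bilinear scaleR_outer_matrix_vector_mult)
    moreover have "?P \<bullet> ?P = s\<^sup>2" "?Q \<bullet> ?Q = t\<^sup>2"
      using j w(1) by (simp_all add: inner_outer_outer u_orthonormal v_orthonormal power2_eq_square)
    moreover have "(s *\<^sub>R outer (u j) y + t *\<^sub>R outer x (v j)) \<bullet> (s *\<^sub>R outer (u j) y + t *\<^sub>R outer x (v j))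
        = s\<^sup>2 * (y \<bullet> y) + t\<^sup>2 * (x \<bullet> x)"
      using j xy by (auto simp: inner_outer_outer u_orthonormal v_orthonormal power2_eq_square)
    ultimately show ?thesis
      using local_minimizer_rpca_second_order[OF min, of ?P ?Q] by (simp only: R_def)
  qed
  show ?thesis
  proof (cases "\<gamma> = 0")
    case False
    then have "x = 0" "y = 0" using xy by auto
    then show ?thesis using so[of 1 1] by simp
  next
    case True
    \<comment> \<open>Scaling the factor whose quadratic cost is zero by \<open>?c\<close> makes the
      gain exceed the remaining fixed cost by 1, so the case is contradictory.\<close>
    let ?c = "(x \<bullet> x + y \<bullet> y + 1) / (2 * \<sigma> j)"
    have c: "2 * (?c * \<sigma> j) = x \<bullet> x + y \<bullet> y + 1" using sigma_pos[OF j(1)] by simp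
    from xy consider "x = 0" | "y = 0" by blast
    then show ?thesis
      by cases (use so[of 1 ?c] so[of ?c 1] c True in \<open>simp_all add: mult.commute\<close>)
  qed
qed

text \<open>The perturbation rotates the singular pair \<open>i\<close> infinitesimally towards the pair \<open>j\<close>.\<close>

lemma discarded_le_kept:
  assumes i: "i \<in> I"
  shows "\<sigma> j \<le> \<sigma> i"
proof -
  define R where "R = A - X ** Y"
  define x where "x = transpose X *v u i"
  define y where "y = Y *v v i"
  define \<kappa> where "\<kappa> = \<sigma> i - \<gamma>"
  have ir: "i < r" and ij: "i \<noteq> j" using i I j by auto
  have \<kappa>: "\<kappa> > 0" using gt[OF i] by (simp add: \<kappa>_def)
  have Mv: "X *v y = \<kappa> *\<^sub>R u i"
    using i ir soft_threshold_v(1)[OF I] by (simp add: y_def \<kappa>_def matrix_vector_mul_assoc M)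
  have Mu: "transpose Y *v x = \<kappa> *\<^sub>R v i"
    using i ir soft_threshold_v(2)[OF I]
    by (simp add: x_def \<kappa>_def matrix_vector_mul_assoc M flip: matrix_transpose_mul)
  have "\<gamma> *\<^sub>R y = (transpose X ** R) *v v i"
    using local_minimizer_imp_stationary[OF min]
    by (simp add: rpca_stationary_def R_def y_def scaleR_matrix_vector_assoc)
  also have "\<dots> = transpose X *v (R *v v i)" by (simp add: matrix_vector_mul_assoc)
  also have "R *v v i = \<gamma> *\<^sub>R u i"
    using ir Mv by (simp add: R_def matrix_vector_mult_diff_rdistrib A_v y_def \<kappa>_def
        matrix_vector_mul_assoc scaleR_diff_left)
  finally have "\<gamma> *\<^sub>R y = \<gamma> *\<^sub>R x" by (simp add: x_def matrix_vector_mult_scaleR)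
  \<comment> \<open>For \<gamma> = 0 the vectors may differ, but then the penalty is absent and only
    \<open>x \<bullet> y\<close> enters the second-order condition.\<close>
  then have xy: "\<gamma> = 0 \<or> x = y" by auto
  have inner: "x \<bullet> y = \<kappa>"
    using ir Mv by (simp add: x_def inner_commute inner_transpose_vector inner_matrix_vector[symmetric]
       u_orthonormal)
  let ?P = "outer (u j) x" and ?Q = "outer y (v j)"
  have "?P ** Y = \<kappa> *\<^sub>R outer (u j) (v i)" "X ** ?Q = \<kappa> *\<^sub>R outer (u i) (v j)"
    by (simp_all add: matrix_mult_outer outer_matrix_mult Mu Mv)
  moreover have "(\<kappa> *\<^sub>R outer (u j) (v i) + \<kappa> *\<^sub>R outer (u i) (v j)) \<bullet>
      (\<kappa> *\<^sub>R outer (u j) (v i) + \<kappa> *\<^sub>R outer (u i) (v j)) = 2 * (\<kappa> * \<kappa>)"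
    using ir ij j by (simp add: inner_add_left inner_add_right inner_outer_outer u_orthonormal v_orthonormal)
  moreover have "R \<bullet> (?P ** ?Q) = \<kappa> * \<sigma> j"
    using residual_v j inner
    by (simp add: matrix_mult_outer outer_matrix_vector_mult inner_outer R_def u_orthonormal)
  moreover have "\<gamma> * (?P \<bullet> ?P + ?Q \<bullet> ?Q) = 2 * (\<gamma> * \<kappa>)"
    using xy inner j by (auto simp add: inner_outer_outer u_orthonormal v_orthonormal)
  \<comment> \<open>The right-hand side is \<open>2 * \<kappa> * \<sigma> i\<close>, since
    \<open>\<kappa> + \<gamma> = \<sigma> i\<close>.\<close>
  ultimately have "2 * (\<kappa> * \<sigma> j) \<le> 2 * (\<kappa> * \<kappa>) + 2 * (\<gamma> * \<kappa>)"
    using local_minimizer_rpca_second_order[OF min, of ?P ?Q] by (simp only: R_def)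
  then have "\<kappa> * \<sigma> j \<le> \<kappa> * \<sigma> i" by (simp add: \<kappa>_def algebra_simps)
  then show ?thesis using \<kappa> by simp
qed

end

section \<open>Uniqueness of the support\<close>

text \<open>The \<open>k\<close> largest singular values above \<gamma>, or all of them if there are
  fewer. The exchange form matches what the second-order conditions deliver and requires no sorting
  of \<sigma>.\<close>

definition optimal_support :: "real \<Rightarrow> nat \<Rightarrow> nat set \<Rightarrow> bool" where
  "optimal_support \<gamma> k I \<longleftrightarrow> I \<subseteq> {..<r} \<and> (\<forall>i\<in>I. \<sigma> i > \<gamma>) \<and> card I \<le> k \<and>
     (\<forall>j\<in>{..<r} - I. \<sigma> j > \<gamma> \<longrightarrow> k \<le> card I \<and> (\<forall>i\<in>I. \<sigma> j \<le> \<sigma> i))"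

lemma local_minimizer_soft_threshold:
  fixes X :: "real^'k^'m" and Y :: "real^'n^'k"
  assumes min: "local_minimizer (rpca_objective A \<gamma>) (X, Y)" and \<gamma>: "\<gamma> \<ge> 0"
  shows "\<exists>I. optimal_support \<gamma> CARD('k) I \<and> X ** Y = soft_threshold \<gamma> I"
proof -
  have "rpca_stationary A \<gamma> X Y" by (rule local_minimizer_imp_stationary[OF min])
  then obtain I where I: "I \<subseteq> {..<r}" "\<And>i. i \<in> I \<Longrightarrow> \<sigma> i > \<gamma>" and M: "X ** Y = soft_threshold \<gamma> I"
    using stationary_imp_soft_threshold_pos[of \<gamma> X Y] stationary_imp_soft_threshold_zero[of X Y] \<gamma>
    by (cases "\<gamma> = 0") auto
  have "optimal_support \<gamma> CARD('k) I"
    unfolding optimal_support_def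
  proof (intro conjI ballI impI)
    show "card I \<le> CARD('k)" by (rule card_soft_threshold_le[OF I M])
    fix j assume j: "j \<in> {..<r} - I" "\<sigma> j > \<gamma>"
    show "CARD('k) \<le> card I"
      using discarded_le_of_rank_deficient[OF min \<gamma> I M, of j] j by fastforce
    show "\<sigma> j \<le> \<sigma> i" if "i \<in> I" for i
      using discarded_le_kept[OF min \<gamma> I M _ _ that, of j] j by simp
  qed (use I in auto)
  with M show ?thesis by blast
qed

text \<open>An index \<open>j\<close> in \<open>J\<close> but not in \<open>I\<close> forces
  \<open>card J \<le> k \<le> card I\<close>, so some \<open>i\<close> in \<open>I\<close> is
  missing from \<open>J\<close>. The two exchange conditions give
  \<open>\<sigma> i = \<sigma> j\<close>, against distinctness.\<close>

lemma optimal_support_subset: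
  assumes I: "optimal_support \<gamma> k I" and J: "optimal_support \<gamma> k J"
  shows "J \<subseteq> I"
proof
  fix j assume j: "j \<in> J"
  show "j \<in> I"
  proof (rule ccontr)
    assume "j \<notin> I"
    then have jI: "k \<le> card I" "\<And>i. i \<in> I \<Longrightarrow> \<sigma> j \<le> \<sigma> i"
      using I J j unfolding optimal_support_def by blast+
    have "finite J" using J unfolding optimal_support_def by (meson finite_lessThan finite_subset)
    moreover have "card J \<le> card I" using J jI(1) unfolding optimal_support_def by linarith
    ultimately have "\<not> I \<subset> J" using psubset_card_mono by (metis not_le)
    then obtain i where i: "i \<in> I" "i \<notin> J" using j \<open>j \<notin> I\<close> by blast
    then have "\<sigma> i \<le> \<sigma> j" using I J j unfolding optimal_support_def by blast
    with jI(2)[OF i(1)] have "\<sigma> i = \<sigma> j" by simp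
    moreover have "i < r" "j < r" using I J i j unfolding optimal_support_def by blast+
    ultimately have "i = j" using inj by (simp add: inj_on_def)
    with i(1) \<open>j \<notin> I\<close> show False by blast
  qed
qed

lemma local_minimizer_product_unique:
  fixes X X' :: "real^'k^'m" and Y Y' :: "real^'n^'k"
  assumes "local_minimizer (rpca_objective A \<gamma>) (X, Y)"
    and "local_minimizer (rpca_objective A \<gamma>) (X', Y')" and "\<gamma> \<ge> 0"
  shows "X ** Y = X' ** Y'"
proof -
  from local_minimizer_soft_threshold[OF assms(1,3)] obtain I
    where "optimal_support \<gamma> CARD('k) I" "X ** Y = soft_threshold \<gamma> I" by blast
  moreover from local_minimizer_soft_threshold[OF assms(2,3)] obtain J
    where "optimal_support \<gamma> CARD('k) J" "X' ** Y' = soft_threshold \<gamma> J" by blast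
  ultimately show ?thesis by (metis optimal_support_subset subset_antisym)
qed

end

section \<open>Existence of a global minimizer\<close>

lemma global_imp_local_minimizer: "global_minimizer f z \<Longrightarrow> local_minimizer f z"
  by (simp add: global_minimizer_def local_minimizer_def)

lemma continuous_on_rpca_objective:
  "continuous_on S (rpca_objective A \<gamma> :: (real^'k^'m) \<times> (real^'n^'k) \<Rightarrow> real)"
proof -
  have eq: "rpca_objective A \<gamma> = (\<lambda>Z::(real^'k^'m) \<times> (real^'n^'k).
      (A - fst Z ** snd Z) \<bullet> (A - fst Z ** snd Z) + \<gamma> * (fst Z \<bullet> fst Z) + \<gamma> * (snd Z \<bullet> snd Z))"
    by (simp add: fun_eq_iff rpca_objective_eq_inner)
  show ?thesis
    unfolding eq
    by (intro continuous_intros bounded_bilinear.continuous_on[OF bounded_bilinear_matrix_mult])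
qed

lemma rpca_objective_eq_norm:
  "rpca_objective A \<gamma> Z = (norm (A - fst Z ** snd Z))\<^sup>2 + \<gamma> * (norm Z)\<^sup>2"
  by (cases Z) (simp add: rpca_objective_eq_inner power2_norm_eq_inner distrib_left)

lemma exists_global_minimizer_pos:
  fixes A :: "real^'n^'m"
  assumes "\<gamma> > 0"
  shows "\<exists>Z :: (real^'k^'m) \<times> (real^'n^'k). global_minimizer (rpca_objective A \<gamma>) Z"
proof -
  let ?f = "rpca_objective A \<gamma> :: (real^'k^'m) \<times> (real^'n^'k) \<Rightarrow> real"
  \<comment> \<open>Outside the ball of this radius the penalty alone is at least
    \<open>(norm A)\<^sup>2\<close>, the objective value at 0.\<close>
  define \<rho> where "\<rho> = norm A / sqrt \<gamma>"
  have "\<rho> \<ge> 0" using assms by (simp add: \<rho>_def)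
  then have "cball 0 \<rho> \<noteq> ({} :: ((real^'k^'m) \<times> (real^'n^'k)) set)" by auto
  then have "\<exists>Z\<in>cball 0 \<rho>. \<forall>W\<in>cball 0 \<rho>. ?f Z \<le> ?f W"
    by (intro continuous_attains_inf compact_cball continuous_on_rpca_objective)
  then obtain Z where Z: "Z \<in> cball 0 \<rho>" "\<And>W. W \<in> cball 0 \<rho> \<Longrightarrow> ?f Z \<le> ?f W"
    by blast
  have "?f Z \<le> ?f W" for W
  proof (cases "W \<in> cball 0 \<rho>")
    case False
    then have "\<rho>\<^sup>2 \<le> (norm W)\<^sup>2" using \<open>\<rho> \<ge> 0\<close> by (intro power_mono) auto
    then have "\<gamma> * \<rho>\<^sup>2 \<le> \<gamma> * (norm W)\<^sup>2" using assms by simp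
    moreover have "\<gamma> * \<rho>\<^sup>2 = (norm A)\<^sup>2" using assms by (simp add: \<rho>_def power_divide)
    moreover have "?f 0 = (norm A)\<^sup>2" by (simp add: rpca_objective_eq_norm matrix_mult_bilinear)
    ultimately have "?f 0 \<le> ?f W" by (simp add: rpca_objective_eq_norm[of A \<gamma> W] add_increasing)
    moreover have "?f Z \<le> ?f 0" using Z(2)[of 0] \<open>\<rho> \<ge> 0\<close> by simp
    ultimately show ?thesis by simp
  qed (use Z in auto)
  then show ?thesis unfolding global_minimizer_def by blast
qed

text \<open>Balancedness gives \<open>X\<^sup>T X\<close> the same norm as \<open>X Y\<close>, and
  the squared norm of \<open>X\<close> is the trace of \<open>X\<^sup>T X\<close>. The bound does
  not involve \<gamma>, so it survives the limit \<gamma> \<rightarrow> 0.\<close>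

lemma stationary_norm_bound:
  fixes X :: "real^'k^'m" and Y :: "real^'n^'k"
  assumes st: "rpca_stationary A \<gamma> X Y" and "\<gamma> > 0"
  shows "(norm (X, Y))\<^sup>2 \<le> 2 * CARD('k) * norm (X ** Y)"
proof -
  define G where "G = transpose X ** X"
  have GY: "G = Y ** transpose Y" using stationary_gram_eq[OF assms] by (simp add: G_def)
  have "G \<bullet> G = (G ** Y) \<bullet> Y"
    using inner_matrix_mult_left[of G Y "transpose Y"] by (simp add: GY)
  also have "\<dots> = (X ** Y) \<bullet> (X ** Y)"
    by (simp add: inner_matrix_mult_right[of "X ** Y" X Y] G_def matrix_mul_assoc)
  finally have G: "norm G = norm (X ** Y)" by (simp add: norm_eq_sqrt_inner)
  have "X \<bullet> X = (\<Sum>l\<in>UNIV. G $ l $ l)"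
    unfolding G_def inner_vec_def by (simp add: matrix_matrix_mult_def transpose_def) (rule sum.swap)
  also have "\<dots> \<le> (\<Sum>l\<in>(UNIV::'k set). norm G)"
  proof (rule sum_mono)
    fix l
    have "G $ l $ l \<le> norm (G $ l $ l)" by simp
    also have "\<dots> \<le> norm (G $ l)" by (rule Finite_Cartesian_Product.norm_nth_le)
    also have "\<dots> \<le> norm G" by (rule Finite_Cartesian_Product.norm_nth_le)
    finally show "G $ l $ l \<le> norm G" .
  qed
  finally have "X \<bullet> X \<le> CARD('k) * norm (X ** Y)" by (simp add: G)
  moreover have "Y \<bullet> Y = X \<bullet> X" using stationary_value[OF st] \<open>\<gamma> > 0\<close>
    by (metis less_irrefl mult_cancel_left)
  ultimately show ?thesis by (simp add: power2_norm_eq_inner)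
qed

lemma exists_global_minimizer:
  fixes A :: "real^'n^'m"
  assumes "\<gamma> \<ge> 0"
  shows "\<exists>Z :: (real^'k^'m) \<times> (real^'n^'k). global_minimizer (rpca_objective A \<gamma>) Z"
proof (cases "\<gamma> = 0")
  case False
  with assms have "\<gamma> > 0" by simp
  then show ?thesis by (rule exists_global_minimizer_pos)
next
  case True
  let ?f = "rpca_objective A :: real \<Rightarrow> (real^'k^'m) \<times> (real^'n^'k) \<Rightarrow> real"
  define g :: "nat \<Rightarrow> real" where "g n = inverse (Suc n)" for n
  have g: "g n > 0" for n by (simp add: g_def)
  have "\<forall>n. \<exists>Z. global_minimizer (?f (g n)) Z"
    using exists_global_minimizer_pos g by blast
  then obtain Z where Z: "\<And>n. global_minimizer (?f (g n)) (Z n)" by metis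
  \<comment> \<open>Comparison with the zero pair bounds the residual by \<open>norm A\<close>,
    hence \<open>X Y\<close> by \<open>2 * norm A\<close>; \<open>stationary_norm_bound\<close> does
    the rest.\<close>
  define B where "B = sqrt (2 * CARD('k) * (2 * norm A))"
  have "norm (Z n) \<le> B" for n
  proof -
    obtain X Y where XY: "Z n = (X, Y)" by (cases "Z n")
    have "(norm (A - X ** Y))\<^sup>2 \<le> ?f (g n) (Z n)"
      using g[of n] by (simp add: rpca_objective_eq_norm XY)
    also have "\<dots> \<le> ?f (g n) 0" using Z unfolding global_minimizer_def by blast
    also have "\<dots> = (norm A)\<^sup>2" by (simp add: rpca_objective_eq_norm matrix_mult_bilinear)
    finally have "norm (A - X ** Y) \<le> norm A" by (rule power2_le_imp_le) simp
    then have "norm (X ** Y) \<le> 2 * norm A"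
      using norm_triangle_ineq4[of A "A - X ** Y"] by simp
    then have "2 * CARD('k) * norm (X ** Y) \<le> 2 * CARD('k) * (2 * norm A)"
      by (intro mult_left_mono) auto
    moreover have "rpca_stationary A (g n) X Y"
      using Z[of n] unfolding XY by (intro local_minimizer_imp_stationary global_imp_local_minimizer)
    ultimately have "(norm (Z n))\<^sup>2 \<le> 2 * CARD('k) * (2 * norm A)"
      using stationary_norm_bound g unfolding XY by (meson order_trans)
    then show ?thesis unfolding B_def by (rule real_le_rsqrt)
  qed
  then have "\<forall>n. Z n \<in> cball 0 B" by simp
  then obtain L \<phi> where \<phi>: "strict_mono \<phi>" "(Z \<circ> \<phi>) \<longlonglongrightarrow> L"
    using compact_cball[of 0 B] unfolding compact_def by metis
  have "?f 0 L \<le> ?f 0 W" for W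
  proof (rule LIMSEQ_le)
    have "isCont (?f 0) L"
      using continuous_on_rpca_objective[of UNIV A 0] continuous_on_eq_continuous_at[OF open_UNIV]
      by blast
    then show "(\<lambda>n. ?f 0 ((Z \<circ> \<phi>) n)) \<longlonglongrightarrow> ?f 0 L" using \<phi>(2) by (rule isCont_tendsto_compose)
    have "g \<longlonglongrightarrow> 0" unfolding g_def by (rule LIMSEQ_inverse_real_of_nat)
    then have "(g \<circ> \<phi>) \<longlonglongrightarrow> 0" using \<phi>(1) by (rule LIMSEQ_subseq_LIMSEQ)
    then have "(\<lambda>n. ?f 0 W + (g \<circ> \<phi>) n * (norm W)\<^sup>2) \<longlonglongrightarrow> ?f 0 W + 0 * (norm W)\<^sup>2"
      by (intro tendsto_intros)
    then show "(\<lambda>n. ?f 0 W + (g \<circ> \<phi>) n * (norm W)\<^sup>2) \<longlonglongrightarrow> ?f 0 W" by simp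
    \<comment> \<open>Dropping the penalty only lowers the left-hand value, while at the fixed
      \<open>W\<close> the penalty tends to 0.\<close>
    have "?f 0 (Z (\<phi> n)) \<le> ?f 0 W + g (\<phi> n) * (norm W)\<^sup>2" for n
    proof -
      have "?f 0 (Z (\<phi> n)) \<le> ?f (g (\<phi> n)) (Z (\<phi> n))"
        using g[of "\<phi> n"] by (simp add: rpca_objective_eq_norm)
      also have "\<dots> \<le> ?f (g (\<phi> n)) W" using Z unfolding global_minimizer_def by blast
      finally show ?thesis by (simp add: rpca_objective_eq_norm)
    qed
    then show "\<exists>N. \<forall>n\<ge>N. ?f 0 ((Z \<circ> \<phi>) n) \<le> ?f 0 W + (g \<circ> \<phi>) n * (norm W)\<^sup>2" by simp
  qed
  then show ?thesis using True unfolding global_minimizer_def by blast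
qed

section \<open>Equality of all local minimal values\<close>

lemma stationary_objective:
  assumes "rpca_stationary A \<gamma> X Y"
  shows "rpca_objective A \<gamma> (X, Y)
    = (A - X ** Y) \<bullet> (A - X ** Y) + 2 * ((A - X ** Y) \<bullet> (X ** Y))"
  using stationary_value[OF assms] by (simp only: rpca_objective_eq_inner)

text \<open>For orthogonal \<open>Q\<close> the pair \<open>(X Q, Q\<^sup>T Y)\<close> has the same
  objective value as \<open>(X, Y)\<close>, so uniqueness can in general hold only for the product
  \<open>X Y\<close>.\<close>

theorem theorem2:
  fixes A :: "real^'n^'m" and \<gamma> :: real
    and f :: "(real^'k^'m) \<times> (real^'n^'k) \<Rightarrow> real"
  assumes "distinct_nonzero_singular_values A"
    and "\<gamma> \<ge> 0"
  defines "f \<equiv> rpca_objective A \<gamma>"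
  shows "(\<exists>X Y. global_minimizer f (X, Y)) \<and>
         (\<forall>X Y. local_minimizer f (X, Y) \<longrightarrow> global_minimizer f (X, Y)) \<and>
         (\<forall>X Y X' Y'. local_minimizer f (X, Y) \<longrightarrow> local_minimizer f (X', Y') \<longrightarrow>
            X ** Y = X' ** Y')"
proof -
  obtain r u \<sigma> v where "is_svd A r u \<sigma> v" "inj_on \<sigma> {..<r}"
    using assms(1) unfolding distinct_nonzero_singular_values_def by blast
  then interpret svd A r u \<sigma> v by unfold_locales
  have unique: "X ** Y = X' ** Y'" if "local_minimizer f (X, Y)" "local_minimizer f (X', Y')"
    for X X' :: "real^'k^'m" and Y Y' :: "real^'n^'k"
    using that \<open>\<gamma> \<ge> 0\<close> unfolding f_def by (rule local_minimizer_product_unique)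
  obtain X0 Y0 where global: "global_minimizer f (X0, Y0)"
    using exists_global_minimizer[OF \<open>\<gamma> \<ge> 0\<close>, of A] unfolding f_def by (metis surj_pair)
  have "global_minimizer f (X, Y)" if local: "local_minimizer f (X, Y)" for X Y
  proof -
    have local0: "local_minimizer f (X0, Y0)" by (rule global_imp_local_minimizer[OF global])
    have "f (X, Y) = f (X0, Y0)"
      using local_minimizer_imp_stationary[OF local[unfolded f_def]]
        local_minimizer_imp_stationary[OF local0[unfolded f_def]]
      by (simp only: f_def stationary_objective unique[OF local local0])
    with global show ?thesis by (simp add: global_minimizer_def)
  qed
  with unique global show ?thesis by blast
qed

end
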